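(* Let $1\le p\le q$ be integers, let $a=(a_0,\dots,a_q)\in\mathcal{A}(p,q)$ be a filter, and let $X=(X_t,\ t\in[0,1])$ be a real-valued random process satisfying Assumption (A) (stated in the context) with limit processes $Y^{(t)}$. Assume in addition that $\mathrm{P}(|\Delta^a_jY^{(t)}|>0)=1$, $j=0,1$, for a.e. $t\in(0,1)$, where $\Delta^a_jZ=\sum_{\ell=0}^q a_\ell Z(j+\ell)$. Then $$\mathrm{E}\left(R^{a,n}(X)-\int_0^1\mathrm{E}\left[\frac{|\Delta^a_0Y^{(t)}+\Delta^a_1Y^{(t)}|}{|\Delta^a_0Y^{(t)}|+|\Delta^a_1Y^{(t)}|}\right]dt\right)^2\ \longrightarrow\ 0\qquad(n\to\infty).$$
   Context: For integers $1\le p\le q$, $\mathcal{A}(p,q)$ is the set of filters $a=(a_0,\dots,a_q)\in\mathbb{R}^{q+1}$ such that $\sum_{\ell=0}^q \ell^i a_\ell=0$ for $i=0,\dots,p-1$ and $\sum_{\ell=0}^q \ell^p a_\ell\ne 0$ (with $0^0=1$). For a filter $a\in\mathcal{A}(p,q)$ and $n>q$, put $\Delta^{a,n}_jX=\sum_{\ell=0}^q a_\ell X_{(j+\ell)/n}$, $j=0,\dots,n-q$, and $$R^{a,n}(X)=\frac{1}{n-q}\sum_{k=0}^{n-q-1}\frac{|\Delta^{a,n}_kX+\Delta^{a,n}_{k+1}X|}{|\Delta^{a,n}_kX|+|\Delta^{a,n}_{k+1}X|},\qquad \tfrac00:=1.$$ Assumption (A): for a.e. pair $(t_1,t_2)\in(0,1)^2$,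 $t_1\ne t_2$, for $i=1,2$ there exist (i) normalizations $A^{(t_i)}(\delta)\to\infty$ as $\delta\to0$ ($\delta>0$), and (ii) mutually independent random processes $Y^{(t_i)}=(Y^{(t_i)}(\tau),\ \tau\ge0)$, $i=1,2$ (the normalization and the law of the process attached to a point $t$ depend on $t$ only), such that, as $\delta\to0$, $s_1\to t_1$, $s_2\to t_2$, $$\Big(A^{(t_1)}(\delta)(X_{s_1+\delta\tau}-X_{s_1}),\ A^{(t_2)}(\delta)(X_{s_2+\delta\tau}-X_{s_2})\Big)\longrightarrow\big(Y^{(t_1)}(\tau),Y^{(t_2)}(\tau)\big)$$ in the sense of weak convergence of finite-dimensional distributions (in $\tau$). *)

theory Defs
  imports "HOL-Probability.Probability"
begin

text \<open>A filter \<open>(a\<^sub>0, \<dots>, a\<^sub>q)\<close> is a function on \<^typ>\<open>nat\<close> of which only the values at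
  \<open>0, \<dots>, q\<close> are ever used.\<close>

definition filter_class :: "nat \<Rightarrow> nat \<Rightarrow> (nat \<Rightarrow> real) set" where
  "filter_class p q =
     {a. (\<forall>i<p. (\<Sum>l\<le>q. real l ^ i * a l) = 0) \<and> (\<Sum>l\<le>q. real l ^ p * a l) \<noteq> 0}"

text \<open>Taking \<open>z i = X\<^bsub>i/n\<^esub>\<close> gives the increments of \<open>X\<close> on the grid of mesh \<open>1/n\<close>, taking
  \<open>z i = Z(i)\<close> gives the increments of mesh 1.\<close>

definition filter_diff :: "nat \<Rightarrow> (nat \<Rightarrow> real) \<Rightarrow> (nat \<Rightarrow> real) \<Rightarrow> nat \<Rightarrow> real" where
  "filter_diff q a z j = (\<Sum>l\<le>q. a l * z (j + l))"

text \<open>The convention is \<open>0/0 = 1\<close>, unlike in HOL.\<close>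

definition ratio :: "real \<Rightarrow> real \<Rightarrow> real" where
  "ratio x y = (if \<bar>x\<bar> + \<bar>y\<bar> = 0 then 1 else \<bar>x + y\<bar> / (\<bar>x\<bar> + \<bar>y\<bar>))"

text \<open>Meaningful for \<open>n > q\<close>.\<close>

definition increment_ratio :: "nat \<Rightarrow> (nat \<Rightarrow> real) \<Rightarrow> nat \<Rightarrow> (real \<Rightarrow> real) \<Rightarrow> real" where
  "increment_ratio q a n x =
     (1 / real (n - q)) *
     (\<Sum>k<n - q. ratio (filter_diff q a (\<lambda>i. x (real i / real n)) k)
                        (filter_diff q a (\<lambda>i. x (real i / real n)) (k + 1)))"

definition random_process :: "'w measure \<Rightarrow> real set \<Rightarrow> (real \<Rightarrow> 'w \<Rightarrow> real) \<Rightarrow> bool" where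
  "random_process M I X \<longleftrightarrow> prob_space M \<and> (\<forall>t\<in>I. X t \<in> borel_measurable M)"

abbreviation path_algebra :: "(real \<Rightarrow> real) measure" where
  "path_algebra \<equiv> Pi\<^sub>M {0..} (\<lambda>_. borel)"

definition path :: "(real \<Rightarrow> 'w \<Rightarrow> real) \<Rightarrow> 'w \<Rightarrow> real \<Rightarrow> real" where
  "path Z w = (\<lambda>\<tau>\<in>{0..}. Z \<tau> w)"

definition process_law :: "'w measure \<Rightarrow> (real \<Rightarrow> 'w \<Rightarrow> real) \<Rightarrow> (real \<Rightarrow> real) measure" where
  "process_law M Z = distr M path_algebra (path Z)"

definition indep_processes ::
  "'w measure \<Rightarrow> (real \<Rightarrow> 'w \<Rightarrow> real) \<Rightarrow> (real \<Rightarrow> 'w \<Rightarrow> real) \<Rightarrow> bool" where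
  "indep_processes M Z1 Z2 \<longleftrightarrow>
     prob_space.indep_var M path_algebra (path Z1) path_algebra (path Z2)"

text \<open>Weak convergence of the finite-dimensional distributions, along \<open>F\<close>, of processes \<open>Z i\<close>
  on \<open>M\<close> to a process \<open>W\<close> on \<open>N\<close>, all indexed by \<open>\<tau> \<ge> 0\<close>: for every finite set \<open>T\<close> of times the
  expectations of every bounded continuous function on the power of the state space with
  exponent \<open>T\<close> converge.\<close>

definition fdd_converges ::
  "'i filter \<Rightarrow> 'w measure \<Rightarrow> ('i \<Rightarrow> real \<Rightarrow> 'w \<Rightarrow> 'b::topological_space) \<Rightarrow>
   'v measure \<Rightarrow> (real \<Rightarrow> 'v \<Rightarrow> 'b) \<Rightarrow> bool" where
  "fdd_converges F M Z N W \<longleftrightarrow>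
     (\<forall>T f. finite T \<and> T \<subseteq> {0..} \<and>
        continuous_map (product_topology (\<lambda>_. euclidean) T) euclideanreal f \<and>
        bounded (f ` topspace (product_topology (\<lambda>_. euclidean :: 'b topology) T)) \<longrightarrow>
        ((\<lambda>i. \<integral>w. f (\<lambda>\<tau>\<in>T. Z i \<tau> w) \<partial>M) \<longlongrightarrow> (\<integral>v. f (\<lambda>\<tau>\<in>T. W \<tau> v) \<partial>N)) F)"

text \<open>Here \<open>Y t\<close>, a process on the probability space \<open>N t\<close>, is a representative of the law
  attached to the point \<open>t\<close>. The independent pair with these two laws lives on a further
  probability space \<open>Q\<close>, which may depend on the pair of points; asking for \<open>Q\<close> on pairs of
  paths is no restriction, as only the joint law of \<open>(Z1, Z2)\<close> matters.
  Since \<open>t1, t2\<close> are interior points, \<open>X\<close> is evaluated in \<open>[0,1]\<close> only, eventually.\<close>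

definition assumption_A ::
  "'w measure \<Rightarrow> (real \<Rightarrow> 'w \<Rightarrow> real) \<Rightarrow> (real \<Rightarrow> real \<Rightarrow> real) \<Rightarrow>
   (real \<Rightarrow> 'v measure) \<Rightarrow> (real \<Rightarrow> real \<Rightarrow> 'v \<Rightarrow> real) \<Rightarrow> bool" where
  "assumption_A M X A N Y \<longleftrightarrow>
     (AE (t1, t2) in (lborel :: (real \<times> real) measure).
        t1 \<in> {0<..<1} \<and> t2 \<in> {0<..<1} \<and> t1 \<noteq> t2 \<longrightarrow>
        filterlim (A t1) at_top (at_right 0) \<and> filterlim (A t2) at_top (at_right 0) \<and>
        random_process (N t1) {0..} (Y t1) \<and> random_process (N t2) {0..} (Y t2) \<and>
        (\<exists>(Q :: ((real \<Rightarrow> real) \<times> (real \<Rightarrow> real)) measure) Z1 Z2.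
           random_process Q {0..} Z1 \<and> random_process Q {0..} Z2 \<and>
           indep_processes Q Z1 Z2 \<and>
           process_law Q Z1 = process_law (N t1) (Y t1) \<and>
           process_law Q Z2 = process_law (N t2) (Y t2) \<and>
           fdd_converges (at_right 0 \<times>\<^sub>F (nhds t1 \<times>\<^sub>F nhds t2))
             M (\<lambda>(\<delta>, s1, s2) \<tau> w. (A t1 \<delta> * (X (s1 + \<delta> * \<tau>) w - X s1 w),
                                       A t2 \<delta> * (X (s2 + \<delta> * \<tau>) w - X s2 w)))
             Q (\<lambda>\<tau> v. (Z1 \<tau> v, Z2 \<tau> v))))"

text \<open>The integral is taken with respect to the completed measure \<^const>\<open>lebesgue\<close>: the \<open>Y t\<close> are
  arbitrary for \<open>t\<close> in a null set, so the integrand need not be Borel measurable.\<close>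

definition limit_ratio ::
  "nat \<Rightarrow> (nat \<Rightarrow> real) \<Rightarrow> (real \<Rightarrow> 'v measure) \<Rightarrow> (real \<Rightarrow> real \<Rightarrow> 'v \<Rightarrow> real) \<Rightarrow> real" where
  "limit_ratio q a N Y =
     (LINT t:{0..1}|lebesgue.
        (\<integral>v. ratio (filter_diff q a (\<lambda>i. Y t (real i) v) 0)
                    (filter_diff q a (\<lambda>i. Y t (real i) v) 1) \<partial>N t))"

end

(* Write R for the increment ratio and L for its claimed limit. Since
   E (R - L)^2 = E R^2 - 2 L E R + L^2, it suffices that E R tends to L and E R^2 to L^2.
   Up to the factor n / (n - q), E R and E R^2 are the integrals, over the unit interval and the
   unit square, of the step functions sending t to E r(t) and (t1, t2) to E (r(t1) r(t2)), where
   r(t) is the summand of R with index floor(n t). By assumption (A) with delta = 1/n these step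
   functions converge almost everywhere, the second one to a product because the limit processes
   are independent; dominated convergence concludes. The ratio is discontinuous only at the
   origin, which the limit law does not charge, and it is invariant under scaling, so that the
   unknown normalization drops out. *)

theory Submission
  imports Defs
begin

section \<open>Dominated convergence and continuous approximation of the ratio\<close>

text \<open>The bound is asked for at positive \<open>n\<close> only, as the grid estimates assume
  \<open>0 < n\<close>; the shift by \<open>Suc\<close> removes index 0 before dominated convergence
  is applied.\<close>

lemma tendsto_integral_dominated:
  fixes f :: "nat \<Rightarrow> 'a \<Rightarrow> real"
  assumes "integrable P b" "\<And>n. f n \<in> borel_measurable P" "g \<in> borel_measurable P"
    and lim: "AE x in P. (\<lambda>n. f n x) \<longlonglongrightarrow> g x" and "\<And>n x. 0 < n \<Longrightarrow> \<bar>f n x\<bar> \<le> b x"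
  shows "(\<lambda>n. integral\<^sup>L P (f n)) \<longlonglongrightarrow> integral\<^sup>L P g"
proof -
  have "(\<lambda>n. integral\<^sup>L P (f (Suc n))) \<longlonglongrightarrow> integral\<^sup>L P g"
  proof (rule integral_dominated_convergence[where w = b])
    show "AE x in P. (\<lambda>n. f (Suc n) x) \<longlonglongrightarrow> g x"
      using lim by eventually_elim (rule LIMSEQ_Suc)
  qed (use assms in auto)
  then show ?thesis by (rule LIMSEQ_imp_Suc)
qed

text \<open>Continuous approximation of the ratio, with error at most \<open>near_zero\<close>, a continuous
  majorant of the indicator of a neighbourhood of the origin.\<close>

definition trunc_ratio :: "nat \<Rightarrow> real \<times> real \<Rightarrow> real" where
  "trunc_ratio j z = \<bar>fst z + snd z\<bar> / max (\<bar>fst z\<bar> + \<bar>snd z\<bar>) (1 / real (Suc j))"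

definition near_zero :: "nat \<Rightarrow> real \<times> real \<Rightarrow> real" where
  "near_zero j z = max 0 (min 1 (2 - real (Suc j) * (\<bar>fst z\<bar> + \<bar>snd z\<bar>)))"

lemma ratio_bounds: "0 \<le> ratio x y" "ratio x y \<le> 1"
  by (auto simp: ratio_def divide_simps)

lemma ratio_mult: "c \<noteq> 0 \<Longrightarrow> ratio (c * x) (c * y) = ratio x y"
  by (simp add: ratio_def abs_mult distrib_left[symmetric] flip: mult.assoc)

lemma borel_measurable_ratio [measurable]:
  assumes [measurable]: "f \<in> borel_measurable M" "g \<in> borel_measurable M"
  shows "(\<lambda>w. ratio (f w) (g w)) \<in> borel_measurable M"
  unfolding ratio_def by measurable

lemma trunc_ratio_bounds: "0 \<le> trunc_ratio j z" "trunc_ratio j z \<le> 1"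
proof -
  have *: "0 < max (\<bar>fst z\<bar> + \<bar>snd z\<bar>) (1 / real (Suc j))"
    by (simp add: less_max_iff_disj)
  then show "0 \<le> trunc_ratio j z"
    unfolding trunc_ratio_def by (intro divide_nonneg_pos) auto
  have "\<bar>fst z + snd z\<bar> \<le> max (\<bar>fst z\<bar> + \<bar>snd z\<bar>) (1 / real (Suc j))"
    by linarith
  with * show "trunc_ratio j z \<le> 1"
    unfolding trunc_ratio_def by simp
qed

lemma near_zero_bounds: "0 \<le> near_zero j z" "near_zero j z \<le> 1"
  by (auto simp: near_zero_def)

lemma continuous_on_trunc_ratio: "continuous_on UNIV (trunc_ratio j)"
proof -
  have "max (\<bar>fst z\<bar> + \<bar>snd z\<bar>) (1 / real (Suc j)) \<noteq> 0" for z :: "real \<times> real"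
    by (rule less_imp_neq[THEN not_sym]) (simp add: less_max_iff_disj)
  then show ?thesis
    unfolding trunc_ratio_def by (intro continuous_intros) auto
qed

lemma continuous_on_near_zero: "continuous_on UNIV (near_zero j)"
  unfolding near_zero_def by (intro continuous_intros)

text \<open>Below the threshold \<open>1 / real (Suc j)\<close> the majorant is 1 and both
  quantities lie in [0,1], which also absorbs the convention 0/0 = 1. From the threshold on, the
  maximum selects the true denominator and the two agree.\<close>

lemma abs_ratio_diff_trunc_ratio: "\<bar>ratio (fst z) (snd z) - trunc_ratio j z\<bar> \<le> near_zero j z"
proof (cases "\<bar>fst z\<bar> + \<bar>snd z\<bar> < 1 / real (Suc j)")
  case True
  then have "real (Suc j) * (\<bar>fst z\<bar> + \<bar>snd z\<bar>) < 1"
    by (simp add: field_simps)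
  then have "near_zero j z = 1"
    by (simp add: near_zero_def)
  then show ?thesis
    using ratio_bounds[of "fst z" "snd z"] trunc_ratio_bounds[of j z] by linarith
next
  case False
  have "0 < 1 / real (Suc j)" by simp
  with False have "\<bar>fst z\<bar> + \<bar>snd z\<bar> \<noteq> 0" by linarith
  with False have "ratio (fst z) (snd z) = trunc_ratio j z"
    by (simp add: ratio_def trunc_ratio_def max_def)
  then show ?thesis
    using near_zero_bounds(1)[of j z] by simp
qed

text \<open>A nonzero first coordinate keeps \<open>z\<close> off the origin, so
  \<open>near_zero j z\<close> is exactly 0 once \<open>real (Suc j)\<close> times the l1 norm of
  \<open>z\<close> exceeds 2.\<close>

lemma near_zero_tendsto_0:
  assumes "fst z \<noteq> 0"
  shows "(\<lambda>j. near_zero j z) \<longlonglongrightarrow> 0"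
proof -
  have pos: "0 < \<bar>fst z\<bar> + \<bar>snd z\<bar>" using assms by linarith
  obtain J where J: "2 < real J * (\<bar>fst z\<bar> + \<bar>snd z\<bar>)"
    using reals_Archimedean3[OF pos] by blast
  have "near_zero j z = 0" if "J \<le> j" for j
  proof -
    have "real J * (\<bar>fst z\<bar> + \<bar>snd z\<bar>) \<le> real (Suc j) * (\<bar>fst z\<bar> + \<bar>snd z\<bar>)"
      using that pos by (intro mult_right_mono) auto
    with J show ?thesis by (simp add: near_zero_def)
  qed
  then show ?thesis
    by (intro tendsto_eventually eventually_sequentiallyI)
qed

section \<open>Step functions on the grid in one variable\<close>

text \<open>Turns sums over grid indices into integrals over time, where dominated convergence is
  available. Written as a sum of indicators, it is visibly measurable and easy to integrate;
  \<open>steps_eq\<close> gives the pointwise values.\<close>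

definition steps :: "nat \<Rightarrow> nat \<Rightarrow> (nat \<Rightarrow> real) \<Rightarrow> real \<Rightarrow> real" where
  "steps n m c t = (\<Sum>k<m. c k * indicator {real k / real n..<real (Suc k) / real n} t)"

text \<open>The grid cell containing \<open>t\<close> has index floor(n t). The condition
  \<open>0 \<le> t\<close> is there because \<open>nat\<close> would send negative floors to cell
  0.\<close>

lemma indicator_grid_interval:
  assumes "0 < n"
  shows "indicator {real k / real n..<real (Suc k) / real n} t
           = (if 0 \<le> t \<and> nat \<lfloor>real n * t\<rfloor> = k then 1 else (0::real))"
proof -
  have "t \<in> {real k / real n..<real (Suc k) / real n} \<longleftrightarrow> \<lfloor>real n * t\<rfloor> = int k"
    using assms by (simp add: floor_eq_iff field_simps)
  also have "\<dots> \<longleftrightarrow> 0 \<le> t \<and> nat \<lfloor>real n * t\<rfloor> = k"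
  proof -
    have "0 \<le> t \<longleftrightarrow> 0 \<le> \<lfloor>real n * t\<rfloor>"
      using assms by (simp add: zero_le_mult_iff)
    then show ?thesis by (auto simp del: zero_le_floor)
  qed
  finally show ?thesis by (simp add: indicator_def)
qed

lemma steps_eq:
  assumes "0 < n"
  shows "steps n m c t = (if 0 \<le> t \<and> nat \<lfloor>real n * t\<rfloor> < m then c (nat \<lfloor>real n * t\<rfloor>) else 0)"
  unfolding steps_def indicator_grid_interval[OF assms]
  by (auto simp: if_distrib[of "(*) _"] sum.delta cong: if_cong)

lemma borel_measurable_steps: "steps n m c \<in> borel_measurable borel"
  unfolding steps_def[abs_def] by measurable

lemma integral_steps:
  assumes "0 < n"
  shows "(LINT t|lborel. steps n m c t) = (\<Sum>k<m. c k) / real n"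
proof -
  have "real (Suc k) / real n - real k / real n = 1 / real n" for k
    by (simp add: diff_divide_distrib[symmetric])
  then show ?thesis
  unfolding steps_def using assms
  by (subst Bochner_Integration.integral_sum)
    (auto simp: divide_right_mono sum_divide_distrib intro!: integrable_real_indicator)
qed

text \<open>The cells are disjoint, so at most one coefficient contributes at each point, and for
  \<open>m \<le> n\<close> all cells lie in the unit interval.\<close>

lemma abs_steps_le:
  assumes "0 < n" "m \<le> n" "\<And>k. \<bar>c k\<bar> \<le> B"
  shows "\<bar>steps n m c t\<bar> \<le> B * indicator {0..1} t"
proof (cases "0 \<le> t \<and> nat \<lfloor>real n * t\<rfloor> < m")
  case True
  then have "\<lfloor>real n * t\<rfloor> < int n" using assms(2) by linarith
  then have "real n * t < real n * 1" by (simp add: floor_less_iff)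
  with assms(1) have "t \<le> 1" by simp
  with True assms show ?thesis by (simp add: steps_eq)
next
  case False
  have "0 \<le> B" using assms(3)[of 0] by linarith
  with False assms(1) show ?thesis by (auto simp: steps_eq)
qed

section \<open>Step functions in two variables and Lebesgue measure on the plane\<close>

definition steps2 :: "nat \<Rightarrow> nat \<Rightarrow> (nat \<Rightarrow> nat \<Rightarrow> real) \<Rightarrow> real \<times> real \<Rightarrow> real" where
  "steps2 n m c z = steps n m (\<lambda>k. steps n m (c k) (snd z)) (fst z)"

lemma borel_measurable_steps2: "steps2 n m c \<in> borel_measurable (borel \<Otimes>\<^sub>M borel)"
  unfolding steps2_def[abs_def] steps_def by measurable

text \<open>\<open>abs_steps_le\<close> is applied twice: the inner bound, an indicator in the
  second variable, serves as the constant \<open>B\<close> of the outer one.\<close>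

lemma abs_steps2_le:
  assumes "0 < n" "m \<le> n" "\<And>k l. \<bar>c k l\<bar> \<le> 1"
  shows "\<bar>steps2 n m c z\<bar> \<le> indicator ({0..1} \<times> {0..1}) z"
proof -
  have "\<bar>steps n m (c k) (snd z)\<bar> \<le> indicator {0..1} (snd z)" for k
    using abs_steps_le[OF assms(1,2), of "c k" 1 "snd z"] assms(3) by simp
  from abs_steps_le[OF assms(1,2) this, of "\<lambda>k. k" "fst z"] show ?thesis
    by (simp add: steps2_def indicator_times mult.commute)
qed

lemma integrable_unit_square:
  "integrable (lborel \<Otimes>\<^sub>M lborel) (indicator ({0..1} \<times> {0..1}) :: real \<times> real \<Rightarrow> real)"
  by (intro integrable_real_indicator) (auto simp: lborel.emeasure_pair_measure_Times)

text \<open>The exceptional set lies in a strip over a null set, which is null because 0 times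
  infinity is 0.\<close>

lemma AE_lborel_pair_fst:
  assumes "AE t in lborel. P (t :: real)"
  shows "AE z in lborel \<Otimes>\<^sub>M (lborel :: real measure). P (fst z)"
proof -
  obtain N where "{t \<in> space lborel. \<not> P t} \<subseteq> N" "emeasure lborel N = 0" "N \<in> sets lborel"
    by (rule AE_E[OF assms])
  then show ?thesis
    by (intro AE_I[where N = "N \<times> UNIV"])
      (auto simp: space_pair_measure lborel.emeasure_pair_measure_Times intro!: pair_measureI)
qed

lemma AE_lborel_pair_snd:
  assumes "AE t in lborel. P (t :: real)"
  shows "AE z in (lborel :: real measure) \<Otimes>\<^sub>M lborel. P (snd z)"
proof -
  obtain N where "{t \<in> space lborel. \<not> P t} \<subseteq> N" "emeasure lborel N = 0" "N \<in> sets lborel"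
    by (rule AE_E[OF assms])
  then show ?thesis
    by (intro AE_I[where N = "UNIV \<times> N"])
      (auto simp: space_pair_measure lborel.emeasure_pair_measure_Times intro!: pair_measureI)
qed

text \<open>Every section of the diagonal is a single point, hence null.\<close>

lemma AE_lborel_pair_off_diagonal:
  "AE z in lborel \<Otimes>\<^sub>M lborel. fst z \<noteq> (snd z :: real)"
proof (rule lborel_pair.AE_pair_measure)
  show "{z \<in> space (lborel \<Otimes>\<^sub>M lborel). fst z \<noteq> (snd z :: real)} \<in> sets (lborel \<Otimes>\<^sub>M lborel)"
    by measurable
  show "AE t in lborel. AE s in lborel. fst (t, s) \<noteq> (snd (t, s) :: real)"
    by (rule AE_I2) (use AE_lborel_singleton in \<open>simp add: eq_commute\<close>)
qed

lemma integral_steps2: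
  assumes n: "0 < n" "m \<le> n" and c: "\<And>k l. \<bar>c k l\<bar> \<le> 1"
  shows "integral\<^sup>L (lborel \<Otimes>\<^sub>M lborel) (steps2 n m c) = (\<Sum>k<m. \<Sum>l<m. c k l) / (real n)\<^sup>2"
proof -
  have meas: "steps2 n m c \<in> borel_measurable (lborel \<Otimes>\<^sub>M lborel)"
    using borel_measurable_steps2 by (simp cong: measurable_cong_sets)
  have "integrable (lborel \<Otimes>\<^sub>M lborel) (steps2 n m c)"
    by (rule Bochner_Integration.integrable_bound[OF integrable_unit_square meas])
      (use abs_steps2_le[of n m c] assms in auto)
  from lborel_pair.integral_fst'[OF this, symmetric]
  have "integral\<^sup>L (lborel \<Otimes>\<^sub>M lborel) (steps2 n m c) = (LINT x|lborel. LINT y|lborel. steps2 n m c (x, y))" .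
  also have "\<dots> = (LINT x|lborel. steps n m (\<lambda>k. LINT y|lborel. steps n m (c k) y) x)"
  proof (intro Bochner_Integration.integral_cong refl)
    \<comment> \<open>For fixed \<open>x\<close> the outer sum is one coefficient or zero, and the
      inner integration passes through it in either case.\<close>
    show "(LINT y|lborel. steps2 n m c (x, y)) = steps n m (\<lambda>k. LINT y|lborel. steps n m (c k) y) x" for x
      by (cases "0 \<le> x \<and> nat \<lfloor>real n * x\<rfloor> < m") (auto simp: steps2_def steps_eq[OF n(1)])
  qed
  also have "\<dots> = (\<Sum>k<m. (\<Sum>l<m. c k l) / real n) / real n"
    by (simp only: integral_steps[OF n(1)])
  finally show ?thesis
    by (simp add: power2_eq_square sum_divide_distrib divide_divide_eq_left)
qed

section \<open>Grid points near a fixed time\<close>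

text \<open>The floor is within 1 of \<open>real n * t\<close>, so the left end of the cell of
  \<open>t\<close> is within \<open>1 / n\<close> of \<open>t\<close>. These left ends are the
  moving base points \<open>s1\<close>, \<open>s2\<close> in Assumption (A).\<close>

lemma grid_point_tendsto:
  assumes "0 \<le> t"
  shows "(\<lambda>n. real (nat \<lfloor>real n * t\<rfloor>) / real n) \<longlonglongrightarrow> t"
proof -
  have eq: "real (nat \<lfloor>real n * t\<rfloor>) = of_int \<lfloor>real n * t\<rfloor>" for n
    using assms by simp
  have "(\<lambda>n. t - 1 / real n) \<longlonglongrightarrow> t - 0"
    by (intro tendsto_intros lim_1_over_n)
  then have lo: "(\<lambda>n. t - 1 / real n) \<longlonglongrightarrow> t" by simp
  show ?thesis
    unfolding eq
  proof (rule real_tendsto_sandwich[OF _ _ lo tendsto_const])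
    show "\<forall>\<^sub>F n in sequentially. t - 1 / real n \<le> of_int \<lfloor>real n * t\<rfloor> / real n"
    proof (rule eventually_sequentiallyI[of 1])
      fix n :: nat assume "1 \<le> n"
      then have "t - 1 / real n = (real n * t - 1) / real n"
        by (simp add: field_simps)
      also have "\<dots> \<le> of_int \<lfloor>real n * t\<rfloor> / real n"
        by (intro divide_right_mono) linarith+
      finally show "t - 1 / real n \<le> of_int \<lfloor>real n * t\<rfloor> / real n" .
    qed
    show "\<forall>\<^sub>F n in sequentially. of_int \<lfloor>real n * t\<rfloor> / real n \<le> t"
    proof (rule eventually_sequentiallyI[of 1])
      fix n :: nat assume "1 \<le> n"
      moreover have "of_int \<lfloor>real n * t\<rfloor> \<le> real n * t" by linarith
      ultimately show "of_int \<lfloor>real n * t\<rfloor> / real n \<le> t"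
        by (simp add: field_simps)
    qed
  qed
qed

text \<open>The increment ratio leaves out the last \<open>q\<close> cells of the unit interval. A
  fixed \<open>t < 1\<close> is nevertheless covered once \<open>n * (1 - t)\<close> exceeds
  \<open>q\<close>.\<close>

lemma eventually_grid_index_less:
  assumes "0 \<le> t" "t < 1"
  shows "\<forall>\<^sub>F n in sequentially. nat \<lfloor>real n * t\<rfloor> < n - q"
proof -
  obtain K where K: "real q < real K * (1 - t)"
    using reals_Archimedean3[of "1 - t"] assms by auto
  show ?thesis
  proof (rule eventually_sequentiallyI)
    fix n assume "K \<le> n"
    then have "real K * (1 - t) \<le> real n * (1 - t)"
      using assms by (intro mult_right_mono) auto
    with K have "real n * t < real n - real q" by (simp add: algebra_simps)
    moreover have "0 \<le> real n * t" using assms by simp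
    ultimately show "nat \<lfloor>real n * t\<rfloor> < n - q" by linarith
  qed
qed

section \<open>Weak convergence tested on discontinuous integrands\<close>

text \<open>The error bound \<open>E j\<close> is itself continuous, so weak convergence controls it
  along \<open>U n\<close> as soon as it is small in the limit, which \<open>E0\<close> ensures for
  large \<open>j\<close>. Measurability of \<open>U n\<close> is asked for eventually, since for
  small \<open>n\<close> the grid indices may run past the end of the grid.\<close>

lemma integral_tendsto_of_approx:
  fixes U :: "nat \<Rightarrow> 'w \<Rightarrow> 'b::topological_space" and V :: "'v \<Rightarrow> 'b"
  assumes M: "prob_space M" and Q: "prob_space Q"
    and H: "H \<in> borel_measurable borel" "\<And>z. \<bar>H z\<bar> \<le> (B::real)"
    and K: "\<And>j. continuous_on UNIV (K j)" "\<And>j z. \<bar>K j z\<bar> \<le> B"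
    and E: "\<And>j. continuous_on UNIV (E j)" "\<And>j z. \<bar>E j z\<bar> \<le> B"
    and HK: "\<And>j z. \<bar>H z - K j z\<bar> \<le> E j z"
    and U: "\<forall>\<^sub>F n in sequentially. U n \<in> borel_measurable M"
    and V [measurable]: "V \<in> borel_measurable Q"
    and lim: "\<And>f :: 'b \<Rightarrow> real. continuous_on UNIV f \<Longrightarrow> bounded (range f) \<Longrightarrow>
                (\<lambda>n. \<integral>w. f (U n w) \<partial>M) \<longlonglongrightarrow> (\<integral>v. f (V v) \<partial>Q)"
    and E0: "AE v in Q. (\<lambda>j. E j (V v)) \<longlonglongrightarrow> 0"
  shows "(\<lambda>n. \<integral>w. H (U n w) \<partial>M) \<longlonglongrightarrow> (\<integral>v. H (V v) \<partial>Q)"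
proof (rule LIMSEQ_I)
  interpret M: prob_space M by fact
  interpret Q: prob_space Q by fact
  have [measurable]: "K j \<in> borel_measurable borel" "E j \<in> borel_measurable borel" for j
    using K(1) E(1) by (auto intro: borel_measurable_continuous_onI)
  note H(1) [measurable]
  \<comment> \<open>Stated over an arbitrary probability space because it serves both for
    \<open>U n\<close> on \<open>M\<close> and for \<open>V\<close> on \<open>Q\<close>.\<close>
  have close: "\<bar>(\<integral>w. H (W w) \<partial>P) - (\<integral>w. K j (W w) \<partial>P)\<bar> \<le> (\<integral>w. E j (W w) \<partial>P)"
    if P: "prob_space P" and [measurable]: "W \<in> borel_measurable P" for j P and W :: "'x \<Rightarrow> 'b"
  proof -
    interpret P: prob_space P by fact
    have int: "integrable P (\<lambda>w. H (W w))" "integrable P (\<lambda>w. K j (W w))" "integrable P (\<lambda>w. E j (W w))"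
      using H(2) K(2) E(2) by (auto intro!: P.integrable_const_bound[where B = B])
    have "\<bar>(\<integral>w. H (W w) \<partial>P) - (\<integral>w. K j (W w) \<partial>P)\<bar> = \<bar>\<integral>w. H (W w) - K j (W w) \<partial>P\<bar>"
      using int by simp
    also have "\<dots> \<le> (\<integral>w. E j (W w) \<partial>P)"
      using int HK by (intro order_trans[OF integral_abs_bound] integral_mono) auto
    finally show ?thesis .
  qed
  have bdd: "bounded (range (K j))" "bounded (range (E j))" for j
    using K(2) E(2) by (auto intro!: boundedI[where B = B])
  have "(\<lambda>j. \<integral>v. E j (V v) \<partial>Q) \<longlonglongrightarrow> (\<integral>v. 0 \<partial>Q)"
    using E(2) E0 by (intro integral_dominated_convergence[where w = "\<lambda>_. B"]) auto
  then have E_lim: "(\<lambda>j. \<integral>v. E j (V v) \<partial>Q) \<longlonglongrightarrow> 0" by simp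
  fix r :: real assume r: "0 < r"
  \<comment> \<open>Three errors, each below \<open>r / 4\<close>, will be added: replacing
    \<open>H\<close> by \<open>K j\<close> along the sequence and in the limit, and the convergence
    of the expectations of \<open>K j\<close>.\<close>
  from order_tendstoD(2)[OF E_lim, of "r/4"] r obtain j where j: "(\<integral>v. E j (V v) \<partial>Q) < r / 4"
    by (auto simp: eventually_sequentially)
  have "\<forall>\<^sub>F n in sequentially. \<bar>(\<integral>w. K j (U n w) \<partial>M) - (\<integral>v. K j (V v) \<partial>Q)\<bar> < r / 4"
    using tendstoD[OF lim[OF K(1)[of j] bdd(1)[of j]], of "r/4"] r by (simp add: dist_real_def)
  moreover have "\<forall>\<^sub>F n in sequentially. (\<integral>w. E j (U n w) \<partial>M) < r / 4"
    by (rule order_tendstoD(2)[OF lim[OF E(1) bdd(2)] j])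
  ultimately have "\<forall>\<^sub>F n in sequentially. norm ((\<integral>w. H (U n w) \<partial>M) - (\<integral>v. H (V v) \<partial>Q)) < r"
    using U
  proof eventually_elim
    case (elim n)
    show ?case
      using close[OF M elim(3), of j] close[OF Q V, of j] elim(1,2) j
      unfolding real_norm_def by linarith
  qed
  then show "\<exists>n0. \<forall>n\<ge>n0. norm ((\<integral>w. H (U n w) \<partial>M) - (\<integral>v. H (V v) \<partial>Q)) < r"
    by (simp add: eventually_sequentially)
qed

section \<open>Increments of mesh 1 as functionals of the path\<close>

text \<open>Takes a path over real time, so that it is a measurable functional on
  \<open>path_algebra\<close> and can be evaluated through \<open>process_law\<close>.\<close>

definition unit_inc :: "nat \<Rightarrow> (nat \<Rightarrow> real) \<Rightarrow> (real \<Rightarrow> real) \<Rightarrow> real \<times> real" where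
  "unit_inc q a z = (filter_diff q a (\<lambda>i. z (real i)) 0, filter_diff q a (\<lambda>i. z (real i)) 1)"

text \<open>Only the times 0 to q + 1 are read, which allows a path to be replaced by its
  restriction to the half-line or to a finite set of times.\<close>

lemma unit_inc_cong:
  assumes "\<And>i. i \<le> Suc q \<Longrightarrow> z (real i) = z' (real i)"
  shows "unit_inc q a z = unit_inc q a z'"
  unfolding unit_inc_def filter_diff_def
  by (intro arg_cong2[where f = Pair] sum.cong refl arg_cong2[where f = "(*)"] assms) auto

lemma measurable_unit_inc [measurable]: "unit_inc q a \<in> borel_measurable path_algebra"
proof -
  have [measurable]: "(\<lambda>z. z (real i)) \<in> borel_measurable path_algebra" for i
    by (rule measurable_component_singleton) simp
  show ?thesis
    unfolding unit_inc_def filter_diff_def by measurable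
qed

lemma unit_inc_path: "unit_inc q a (path Z v) = unit_inc q a (\<lambda>\<tau>. Z \<tau> v)"
  by (intro unit_inc_cong) (simp add: path_def)

lemma measurable_path [measurable]:
  assumes "random_process M {0..} Z"
  shows "path Z \<in> M \<rightarrow>\<^sub>M path_algebra"
  using assms unfolding path_def random_process_def by (intro measurable_restrict) auto

text \<open>The increments are linear in finitely many coordinates, hence continuous for the product
  topology, so \<open>f\<close> composed with them is an admissible test function for the
  finite-dimensional distributions.\<close>

lemma fdd_converges_unit_inc:
  fixes Z :: "'i \<Rightarrow> real \<Rightarrow> 'w \<Rightarrow> real \<times> real" and W :: "real \<Rightarrow> 'v \<Rightarrow> real \<times> real"
    and f :: "(real \<times> real) \<times> (real \<times> real) \<Rightarrow> real"
  assumes "fdd_converges F M Z N W" and f: "continuous_on UNIV f" "bounded (range f)"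
  shows "((\<lambda>i. \<integral>w. f (unit_inc q a (\<lambda>\<tau>. fst (Z i \<tau> w)), unit_inc q a (\<lambda>\<tau>. snd (Z i \<tau> w))) \<partial>M)
            \<longlongrightarrow> (\<integral>v. f (unit_inc q a (\<lambda>\<tau>. fst (W \<tau> v)), unit_inc q a (\<lambda>\<tau>. snd (W \<tau> v))) \<partial>N)) F"
proof -
  \<comment> \<open>The times read by the increments with offsets 0 and 1.\<close>
  define T where "T = real ` {..Suc q}"
  define g where "g z = f (unit_inc q a (\<lambda>\<tau>. fst (z \<tau>)), unit_inc q a (\<lambda>\<tau>. snd (z \<tau>)))"
    for z :: "real \<Rightarrow> real \<times> real"
  have T: "finite T" "T \<subseteq> {0..}"
    by (auto simp: T_def)
  let ?P = "product_topology (\<lambda>_. euclidean :: (real \<times> real) topology) T"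
  have coord: "continuous_map ?P euclideanreal (\<lambda>z. fst (z (real i)))"
    "continuous_map ?P euclideanreal (\<lambda>z. snd (z (real i)))" if "i \<le> Suc q" for i
  proof -
    have *: "continuous_map ?P euclidean (\<lambda>z. z (real i))"
      by (rule continuous_map_product_projection) (use that in \<open>auto simp: T_def\<close>)
    show "continuous_map ?P euclideanreal (\<lambda>z. fst (z (real i)))"
      using continuous_map_compose[OF *, of euclideanreal fst] by (simp add: o_def continuous_on_fst)
    show "continuous_map ?P euclideanreal (\<lambda>z. snd (z (real i)))"
      using continuous_map_compose[OF *, of euclideanreal snd] by (simp add: o_def continuous_on_snd)
  qed
  have pair: "continuous_map ?P euclidean (\<lambda>z. (u z, v z))"
    if "continuous_map ?P euclidean u" "continuous_map ?P euclidean v"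
    for u :: "_ \<Rightarrow> 'x::topological_space" and v :: "_ \<Rightarrow> 'y::topological_space"
    using that by (simp flip: prod_topology_euclidean add: continuous_map_pairwise o_def)
  have fd: "continuous_map ?P euclideanreal (\<lambda>z. filter_diff q a (\<lambda>i. fst (z (real i))) j)"
    "continuous_map ?P euclideanreal (\<lambda>z. filter_diff q a (\<lambda>i. snd (z (real i))) j)" if "j \<le> 1" for j
    using that unfolding filter_diff_def
    by (auto simp del: of_nat_add intro!: continuous_map_sum continuous_map_real_mult coord)
  have "continuous_map ?P euclidean
          (\<lambda>z. (unit_inc q a (\<lambda>\<tau>. fst (z \<tau>)), unit_inc q a (\<lambda>\<tau>. snd (z \<tau>))))"
    unfolding unit_inc_def by (intro pair fd) auto
  from continuous_map_compose[OF this, of euclideanreal f]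
  have "continuous_map ?P euclideanreal g"
    using f(1) by (simp add: o_def g_def[abs_def])
  moreover have "bounded (g ` topspace ?P)"
    by (rule bounded_subset[OF f(2)]) (auto simp: g_def)
  ultimately have "((\<lambda>i. \<integral>w. g (\<lambda>\<tau>\<in>T. Z i \<tau> w) \<partial>M) \<longlongrightarrow> (\<integral>v. g (\<lambda>\<tau>\<in>T. W \<tau> v) \<partial>N)) F"
    using assms(1)[unfolded fdd_converges_def, rule_format, of T g] T by blast
  moreover have "g (\<lambda>\<tau>\<in>T. z \<tau>) = f (unit_inc q a (\<lambda>\<tau>. fst (z \<tau>)), unit_inc q a (\<lambda>\<tau>. snd (z \<tau>)))" for z
    unfolding g_def by (intro arg_cong[where f = f] arg_cong2[where f = Pair] unit_inc_cong) (auto simp: T_def)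
  ultimately show ?thesis by simp
qed

section \<open>Grid increments, scaling, and transfer between equal laws\<close>

definition pratio :: "real \<times> real \<Rightarrow> real" where
  "pratio z = ratio (fst z) (snd z)"

definition grid_inc :: "nat \<Rightarrow> (nat \<Rightarrow> real) \<Rightarrow> nat \<Rightarrow> nat \<Rightarrow> (real \<Rightarrow> real) \<Rightarrow> real \<times> real" where
  "grid_inc q a n k x =
     (filter_diff q a (\<lambda>i. x (real i / real n)) k, filter_diff q a (\<lambda>i. x (real i / real n)) (k + 1))"

lemma pratio_bounds: "0 \<le> pratio z" "pratio z \<le> 1"
  by (auto simp: pratio_def ratio_bounds)

lemma pratio_scaleR: "c \<noteq> 0 \<Longrightarrow> pratio (c *\<^sub>R z) = pratio z"
  by (simp add: pratio_def ratio_mult)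

lemma measurable_pratio [measurable]: "pratio \<in> borel_measurable borel"
  unfolding pratio_def borel_prod[symmetric] by measurable

text \<open>A filter of vanishing sum annihilates constants, so the base value \<open>b\<close>
  cancels and only the factor survives.\<close>

lemma filter_diff_affine:
  assumes "(\<Sum>l\<le>q. a l) = 0"
  shows "filter_diff q a (\<lambda>i. c * (z i - b)) j = c * filter_diff q a z j"
proof -
  have "filter_diff q a (\<lambda>i. c * (z i - b)) j = c * filter_diff q a z j - (\<Sum>l\<le>q. a l) * (c * b)"
    unfolding filter_diff_def sum_distrib_left sum_distrib_right sum_subtractf[symmetric]
    by (intro sum.cong) (auto simp: algebra_simps)
  with assms show ?thesis by simp
qed

text \<open>With mesh 1/n and base point k/n, the times of Assumption (A) are the grid points (k +
  i)/n. Its normalized local increments are therefore grid increments up to the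
  normalization.\<close>

lemma unit_inc_rescaled_grid:
  assumes "(\<Sum>l\<le>q. a l) = 0"
  shows "unit_inc q a (\<lambda>\<tau>. c * (x (real k / real n + 1 / real n * \<tau>) - x (real k / real n)))
           = c *\<^sub>R grid_inc q a n k x"
proof -
  have eq: "real k / real n + 1 / real n * real i = real (k + i) / real n" for i
    by (simp add: add_divide_distrib)
  show ?thesis
    unfolding unit_inc_def grid_inc_def filter_diff_affine[OF assms] eq
    by (simp add: filter_diff_def add_ac)
qed

text \<open>The bound \<open>k < n - q\<close> makes the last grid index read,
  \<open>k + 1 + q\<close>, at most \<open>n\<close>, so \<open>X\<close> is sampled inside the unit
  interval.\<close>

lemma measurable_grid_inc:
  assumes X: "random_process M {0..1} X" and "k < n - q"
  shows "(\<lambda>w. grid_inc q a n k (\<lambda>t. X t w)) \<in> borel_measurable M"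
proof -
  have "X (real i / real n) \<in> borel_measurable M" if "i \<le> n" for i
    using X that by (auto simp: random_process_def divide_simps)
  then have "(\<lambda>w. filter_diff q a (\<lambda>i. X (real i / real n) w) j) \<in> borel_measurable M"
    if "j \<le> k + 1" for j
    using that assms(2) unfolding filter_diff_def
    by (intro borel_measurable_sum borel_measurable_times borel_measurable_const) (auto simp del: of_nat_add)
  then show ?thesis
    unfolding grid_inc_def by (intro borel_measurable_Pair) auto
qed

text \<open>Assumption (A) ties the independent pair to the processes \<open>Y t\<close> through
  their laws; this lemma and the next carry expectations and almost sure statements across.\<close>

lemma integral_process_law:
  assumes "random_process M {0..} Z" and [measurable]: "g \<in> borel_measurable path_algebra"
  shows "(\<integral>v. g (path Z v) \<partial>M) = (\<integral>z. (g z :: real) \<partial>process_law M Z)"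
  using measurable_path[OF assms(1)] unfolding process_law_def
  by (subst integral_distr) auto

lemma AE_process_law:
  assumes "random_process M {0..} Z" and [measurable]: "Measurable.pred path_algebra P"
  shows "(AE v in M. P (path Z v)) \<longleftrightarrow> (AE z in process_law M Z. P z)"
  using measurable_path[OF assms(1)] unfolding process_law_def
  by (subst AE_distr_iff) auto

lemma measurable_unit_inc_process:
  assumes "random_process M {0..} Z"
  shows "(\<lambda>v. unit_inc q a (\<lambda>\<tau>. Z \<tau> v)) \<in> borel_measurable M"
  using measurable_compose[OF measurable_path[OF assms] measurable_unit_inc, of q a] by (simp add: unit_inc_path)

section \<open>Assumption (A) along the grid\<close>

text \<open>Assumption (A) is read along mesh 1/n, with base points at the left ends of the cells of
  \<open>t1\<close> and \<open>t2\<close>. Invariance of \<open>H\<close> under separate scaling of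
  its two arguments then removes the unknown normalizations.\<close>

lemma integral_tendsto_grid:
  fixes X :: "real \<Rightarrow> 'w \<Rightarrow> real" and H :: "(real \<times> real) \<times> (real \<times> real) \<Rightarrow> real"
  assumes X: "random_process M {0..1} X" and a: "(\<Sum>l\<le>q. a l) = 0"
    and t: "t1 \<in> {0<..<1}" "t2 \<in> {0<..<1}"
    and A: "filterlim A1 at_top (at_right 0)" "filterlim A2 at_top (at_right 0)"
    and Z: "random_process Q {0..} Z1" "random_process Q {0..} Z2"
    and fdd: "fdd_converges (at_right 0 \<times>\<^sub>F (nhds t1 \<times>\<^sub>F nhds t2))
             M (\<lambda>(\<delta>, s1, s2) \<tau> w. (A1 \<delta> * (X (s1 + \<delta> * \<tau>) w - X s1 w),
                                       A2 \<delta> * (X (s2 + \<delta> * \<tau>) w - X s2 w)))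
             Q (\<lambda>\<tau> v. (Z1 \<tau> v, Z2 \<tau> v))"
    and H: "H \<in> borel_measurable borel" "\<And>z. \<bar>H z\<bar> \<le> B"
    and H_scale: "\<And>c1 c2 z1 z2. c1 \<noteq> 0 \<Longrightarrow> c2 \<noteq> 0 \<Longrightarrow> H (c1 *\<^sub>R z1, c2 *\<^sub>R z2) = H (z1, z2)"
    and K: "\<And>j. continuous_on UNIV (K j)" "\<And>j z. \<bar>K j z\<bar> \<le> B"
    and E: "\<And>j. continuous_on UNIV (E j)" "\<And>j z. \<bar>E j z\<bar> \<le> B"
    and HK: "\<And>j z. \<bar>H z - K j z\<bar> \<le> E j z"
    and E0: "AE v in Q. (\<lambda>j. E j (unit_inc q a (\<lambda>\<tau>. Z1 \<tau> v), unit_inc q a (\<lambda>\<tau>. Z2 \<tau> v))) \<longlonglongrightarrow> 0"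
  shows "(\<lambda>n. \<integral>w. H (grid_inc q a n (nat \<lfloor>real n * t1\<rfloor>) (\<lambda>t. X t w),
                      grid_inc q a n (nat \<lfloor>real n * t2\<rfloor>) (\<lambda>t. X t w)) \<partial>M)
           \<longlonglongrightarrow> (\<integral>v. H (unit_inc q a (\<lambda>\<tau>. Z1 \<tau> v), unit_inc q a (\<lambda>\<tau>. Z2 \<tau> v)) \<partial>Q)"
proof -
  \<comment> \<open>The normalized grid increments, to which the convergence in (A) applies.\<close>
  define U where "U n w = (A1 (1 / real n) *\<^sub>R grid_inc q a n (nat \<lfloor>real n * t1\<rfloor>) (\<lambda>t. X t w),
      A2 (1 / real n) *\<^sub>R grid_inc q a n (nat \<lfloor>real n * t2\<rfloor>) (\<lambda>t. X t w))" for n w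
  have \<delta>: "filterlim (\<lambda>n. 1 / real n) (at_right 0) sequentially"
    unfolding filterlim_at
    by (auto simp: lim_1_over_n intro!: eventually_sequentiallyI[of 1])
  have pt: "filterlim (\<lambda>n. (1 / real n, real (nat \<lfloor>real n * t1\<rfloor>) / real n, real (nat \<lfloor>real n * t2\<rfloor>) / real n))
      (at_right 0 \<times>\<^sub>F (nhds t1 \<times>\<^sub>F nhds t2)) sequentially"
    using t by (intro filterlim_Pair \<delta> grid_point_tendsto) auto
  have lim: "(\<lambda>n. \<integral>w. f (U n w) \<partial>M) \<longlonglongrightarrow> (\<integral>v. f (unit_inc q a (\<lambda>\<tau>. Z1 \<tau> v), unit_inc q a (\<lambda>\<tau>. Z2 \<tau> v)) \<partial>Q)"
    if f: "continuous_on UNIV f" "bounded (range f)" for f :: "(real \<times> real) \<times> (real \<times> real) \<Rightarrow> real"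
    using filterlim_compose[OF fdd_converges_unit_inc[OF fdd f] pt, of q a]
    unfolding U_def unit_inc_rescaled_grid[OF a, symmetric]
    by (simp only: split fst_conv snd_conv)
  have idx: "\<forall>\<^sub>F n in sequentially. nat \<lfloor>real n * t1\<rfloor> < n - q \<and> nat \<lfloor>real n * t2\<rfloor> < n - q"
    using t by (intro eventually_conj eventually_grid_index_less) auto
  have U: "\<forall>\<^sub>F n in sequentially. U n \<in> borel_measurable M"
    using idx
  proof eventually_elim
    case (elim n)
    then show ?case
      unfolding U_def[abs_def]
      by (intro borel_measurable_Pair borel_measurable_scaleR borel_measurable_const measurable_grid_inc[OF X]) auto
  qed
  have "(\<lambda>n. \<integral>w. H (U n w) \<partial>M) \<longlonglongrightarrow> (\<integral>v. H (unit_inc q a (\<lambda>\<tau>. Z1 \<tau> v), unit_inc q a (\<lambda>\<tau>. Z2 \<tau> v)) \<partial>Q)"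
  proof (rule integral_tendsto_of_approx[OF _ _ H K E HK U _ lim E0])
    show "prob_space M" "prob_space Q"
      using X Z by (auto simp: random_process_def)
    show "(\<lambda>v. (unit_inc q a (\<lambda>\<tau>. Z1 \<tau> v), unit_inc q a (\<lambda>\<tau>. Z2 \<tau> v))) \<in> borel_measurable Q"
      by (intro borel_measurable_Pair measurable_unit_inc_process Z)
  qed
  \<comment> \<open>The normalizations tend to infinity, so they are eventually positive and
    \<open>H_scale\<close> removes them.\<close>
  moreover have "\<forall>\<^sub>F n in sequentially. (\<integral>w. H (U n w) \<partial>M)
      = (\<integral>w. H (grid_inc q a n (nat \<lfloor>real n * t1\<rfloor>) (\<lambda>t. X t w),
                grid_inc q a n (nat \<lfloor>real n * t2\<rfloor>) (\<lambda>t. X t w)) \<partial>M)"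
    using eventually_compose_filterlim[OF filterlim_at_top_dense[THEN iffD1, OF A(1), rule_format, of 0] \<delta>]
      eventually_compose_filterlim[OF filterlim_at_top_dense[THEN iffD1, OF A(2), rule_format, of 0] \<delta>]
    by eventually_elim (simp add: U_def H_scale)
  ultimately show ?thesis
    by (rule Lim_transform_eventually)
qed

section \<open>First and mixed second moments of the ratio at fixed times\<close>

text \<open>At \<open>N t\<close> and \<open>Y t\<close> this is the integrand of
  \<open>limit_ratio\<close>.\<close>

definition mean_ratio :: "nat \<Rightarrow> (nat \<Rightarrow> real) \<Rightarrow> 'v measure \<Rightarrow> (real \<Rightarrow> 'v \<Rightarrow> real) \<Rightarrow> real" where
  "mean_ratio q a P Z = (\<integral>v. pratio (unit_inc q a (\<lambda>\<tau>. Z \<tau> v)) \<partial>P)"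

text \<open>Both claims are instances of \<open>integral_tendsto_grid\<close>, with \<open>H\<close>
  the ratio at the first point or the product of the ratios at both points. Independence factorizes
  the second limit, and equality of laws replaces \<open>Z1\<close>, \<open>Z2\<close> by
  \<open>Y1\<close>, \<open>Y2\<close>.\<close>

lemma grid_ratio_limits:
  fixes q :: nat and a :: "nat \<Rightarrow> real" and X :: "real \<Rightarrow> 'w \<Rightarrow> real"
  defines "r n t w \<equiv> pratio (grid_inc q a n (nat \<lfloor>real n * t\<rfloor>) (\<lambda>s. X s w))"
  assumes X: "random_process M {0..1} X" and a: "(\<Sum>l\<le>q. a l) = 0"
    and t: "t1 \<in> {0<..<1}" "t2 \<in> {0<..<1}"
    and A: "filterlim A1 at_top (at_right 0)" "filterlim A2 at_top (at_right 0)"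
    and Y: "random_process N1 {0..} Y1" "random_process N2 {0..} Y2"
    and Z: "random_process Q {0..} Z1" "random_process Q {0..} Z2"
    and indep: "indep_processes Q Z1 Z2"
    and law: "process_law Q Z1 = process_law N1 Y1" "process_law Q Z2 = process_law N2 Y2"
    and fdd: "fdd_converges (at_right 0 \<times>\<^sub>F (nhds t1 \<times>\<^sub>F nhds t2))
             M (\<lambda>(\<delta>, s1, s2) \<tau> w. (A1 \<delta> * (X (s1 + \<delta> * \<tau>) w - X s1 w),
                                       A2 \<delta> * (X (s2 + \<delta> * \<tau>) w - X s2 w)))
             Q (\<lambda>\<tau> v. (Z1 \<tau> v, Z2 \<tau> v))"
    and nz1: "AE v in N1. fst (unit_inc q a (\<lambda>\<tau>. Y1 \<tau> v)) \<noteq> 0"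
  shows grid_ratio_limit: "(\<lambda>n. \<integral>w. r n t1 w \<partial>M) \<longlonglongrightarrow> mean_ratio q a N1 Y1"
    and grid_ratio_limit_pair: "AE v in N2. fst (unit_inc q a (\<lambda>\<tau>. Y2 \<tau> v)) \<noteq> 0 \<Longrightarrow>
      (\<lambda>n. \<integral>w. r n t1 w * r n t2 w \<partial>M) \<longlonglongrightarrow> mean_ratio q a N1 Y1 * mean_ratio q a N2 Y2"
proof -
  interpret Q: prob_space Q using Z by (auto simp: random_process_def)
  note [measurable] = measurable_unit_inc_process[OF Z(1)] measurable_unit_inc_process[OF Z(2)]
  \<comment> \<open>Nondegeneracy is a property of the path, so it passes from \<open>Y\<close> to
    its copy on \<open>Q\<close> by equality of laws.\<close>
  have nz: "AE v in Q. fst (unit_inc q a (\<lambda>\<tau>. W \<tau> v)) \<noteq> 0"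
    if "random_process Q {0..} W" "random_process P {0..} Y" "process_law Q W = process_law P Y"
      "AE v in P. fst (unit_inc q a (\<lambda>\<tau>. Y \<tau> v)) \<noteq> 0" for W P and Y :: "real \<Rightarrow> 'z \<Rightarrow> real"
  proof -
    have "unit_inc q a \<in> path_algebra \<rightarrow>\<^sub>M borel \<Otimes>\<^sub>M borel"
      using measurable_unit_inc by (simp add: borel_prod)
    then have m: "Measurable.pred path_algebra (\<lambda>z. fst (unit_inc q a z) \<noteq> 0)" by measurable
    show ?thesis
      using that(4) AE_process_law[OF that(1) m] AE_process_law[OF that(2) m]
      unfolding unit_inc_path that(3) by blast
  qed
  have mean_eq: "mean_ratio q a Q W = mean_ratio q a P Y"
    if "random_process Q {0..} W" "random_process P {0..} Y" "process_law Q W = process_law P Y"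
    for W P and Y :: "real \<Rightarrow> 'z \<Rightarrow> real"
  proof -
    have m: "(\<lambda>z. pratio (unit_inc q a z)) \<in> borel_measurable path_algebra" by measurable
    show ?thesis
      using integral_process_law[OF that(1) m] integral_process_law[OF that(2) m] that(3)
      by (simp add: unit_inc_path mean_ratio_def)
  qed
  note cts = continuous_on_compose2[OF continuous_on_trunc_ratio] continuous_on_compose2[OF continuous_on_near_zero]
  have [measurable]: "(\<lambda>z. pratio (fst z)) \<in> borel_measurable borel"
    "(\<lambda>z. pratio (snd z)) \<in> borel_measurable borel"
    by (intro measurable_compose[OF borel_measurable_continuous_onI measurable_pratio] continuous_intros)+
  have err: "\<bar>pratio z - trunc_ratio j z\<bar> \<le> near_zero j z" for j z
    unfolding pratio_def by (rule abs_ratio_diff_trunc_ratio)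
  have abs_bd: "\<bar>pratio z\<bar> \<le> 1" "\<bar>trunc_ratio j z\<bar> \<le> 1" "\<bar>near_zero j z\<bar> \<le> 1" for j z
    using pratio_bounds trunc_ratio_bounds near_zero_bounds by simp_all
  have "(\<lambda>n. \<integral>w. r n t1 w \<partial>M) \<longlonglongrightarrow> mean_ratio q a Q Z1"
    unfolding r_def mean_ratio_def
  proof (rule integral_tendsto_grid[OF X a t A Z fdd, where B = 1
        and H = "\<lambda>z. pratio (fst z)" and K = "\<lambda>j z. trunc_ratio j (fst z)"
        and E = "\<lambda>j z. near_zero j (fst z)", simplified fst_conv])
    show "AE v in Q. (\<lambda>j. near_zero j (unit_inc q a (\<lambda>\<tau>. Z1 \<tau> v))) \<longlonglongrightarrow> 0"
      using nz[OF Z(1) Y(1) law(1) nz1] by eventually_elim (rule near_zero_tendsto_0)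
  qed (auto simp: abs_bd pratio_scaleR err intro!: cts continuous_intros)
  then show "(\<lambda>n. \<integral>w. r n t1 w \<partial>M) \<longlonglongrightarrow> mean_ratio q a N1 Y1"
    using mean_eq[OF Z(1) Y(1) law(1)] by simp
  assume nz2: "AE v in N2. fst (unit_inc q a (\<lambda>\<tau>. Y2 \<tau> v)) \<noteq> 0"
  have "(\<lambda>n. \<integral>w. r n t1 w * r n t2 w \<partial>M)
      \<longlonglongrightarrow> (\<integral>v. pratio (unit_inc q a (\<lambda>\<tau>. Z1 \<tau> v)) * pratio (unit_inc q a (\<lambda>\<tau>. Z2 \<tau> v)) \<partial>Q)"
    unfolding r_def
  \<comment> \<open>Here \<open>B = 2\<close>, because the error is a sum of two majorants, each at
    most 1.\<close>
  proof (rule integral_tendsto_grid[OF X a t A Z fdd, where B = 2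
        and H = "\<lambda>z. pratio (fst z) * pratio (snd z)"
        and K = "\<lambda>j z. trunc_ratio j (fst z) * trunc_ratio j (snd z)"
        and E = "\<lambda>j z. near_zero j (fst z) + near_zero j (snd z)", simplified fst_conv snd_conv])
    show "(\<lambda>z. pratio (fst z) * pratio (snd z)) \<in> borel_measurable borel" by measurable
    fix z :: "(real \<times> real) \<times> (real \<times> real)" and j
    have "\<bar>pratio (fst z) * pratio (snd z)\<bar> \<le> 1" "\<bar>trunc_ratio j (fst z) * trunc_ratio j (snd z)\<bar> \<le> 1"
      unfolding abs_mult by (intro mult_le_one abs_bd abs_ge_zero)+
    then show "\<bar>pratio (fst z) * pratio (snd z)\<bar> \<le> 2" "\<bar>trunc_ratio j (fst z) * trunc_ratio j (snd z)\<bar> \<le> 2" by simp_all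
    show "\<bar>near_zero j (fst z) + near_zero j (snd z)\<bar> \<le> 2"
      using abs_bd(3)[of j "fst z"] abs_bd(3)[of j "snd z"] by linarith
    \<comment> \<open>Changing one factor at a time bounds the error of the product by the sum of
      the two errors, as the remaining factor is at most 1 in absolute value.\<close>
    have "\<bar>pratio (fst z) * pratio (snd z) - trunc_ratio j (fst z) * trunc_ratio j (snd z)\<bar>
        = \<bar>(pratio (fst z) - trunc_ratio j (fst z)) * pratio (snd z) + trunc_ratio j (fst z) * (pratio (snd z) - trunc_ratio j (snd z))\<bar>"
      by (simp add: algebra_simps)
    also have "\<dots> \<le> \<bar>pratio (fst z) - trunc_ratio j (fst z)\<bar> * \<bar>pratio (snd z)\<bar> + \<bar>trunc_ratio j (fst z)\<bar> * \<bar>pratio (snd z) - trunc_ratio j (snd z)\<bar>"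
      unfolding abs_mult[symmetric] by (rule abs_triangle_ineq)
    also have "\<dots> \<le> near_zero j (fst z) * 1 + 1 * near_zero j (snd z)"
      by (intro add_mono mult_mono err abs_bd abs_ge_zero near_zero_bounds) auto
    finally show "\<bar>pratio (fst z) * pratio (snd z) - trunc_ratio j (fst z) * trunc_ratio j (snd z)\<bar> \<le> near_zero j (fst z) + near_zero j (snd z)"
      by simp
  next
    show "AE v in Q. (\<lambda>j. near_zero j (unit_inc q a (\<lambda>\<tau>. Z1 \<tau> v)) + near_zero j (unit_inc q a (\<lambda>\<tau>. Z2 \<tau> v))) \<longlonglongrightarrow> 0"
      using nz[OF Z(1) Y(1) law(1) nz1] nz[OF Z(2) Y(2) law(2) nz2]
      by eventually_elim (auto intro!: tendsto_add_zero near_zero_tendsto_0)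
  qed (auto simp: pratio_scaleR intro!: cts continuous_intros)
  also have "(\<integral>v. pratio (unit_inc q a (\<lambda>\<tau>. Z1 \<tau> v)) * pratio (unit_inc q a (\<lambda>\<tau>. Z2 \<tau> v)) \<partial>Q) = mean_ratio q a Q Z1 * mean_ratio q a Q Z2"
  proof -
    \<comment> \<open>Measurable functions of independent paths are independent, and bounded here,
      so the expectation of their product factorizes.\<close>
    have "Q.indep_var borel ((\<lambda>z. pratio (unit_inc q a z)) \<circ> path Z1) borel ((\<lambda>z. pratio (unit_inc q a z)) \<circ> path Z2)"
      by (rule Q.indep_var_compose[OF indep[unfolded indep_processes_def]]) measurable
    then have "Q.indep_var borel (\<lambda>v. pratio (unit_inc q a (\<lambda>\<tau>. Z1 \<tau> v))) borel (\<lambda>v. pratio (unit_inc q a (\<lambda>\<tau>. Z2 \<tau> v)))"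
      by (simp add: o_def unit_inc_path)
    then show ?thesis
      unfolding mean_ratio_def
      by (rule Q.indep_var_lebesgue_integral)
        (auto intro!: Q.integrable_const_bound[where B = 1] simp: abs_bd)
  qed
  finally show "(\<lambda>n. \<integral>w. r n t1 w * r n t2 w \<partial>M) \<longlonglongrightarrow> mean_ratio q a N1 Y1 * mean_ratio q a N2 Y2"
    using mean_eq[OF Z(1) Y(1) law(1)] mean_eq[OF Z(2) Y(2) law(2)] by simp
qed

section \<open>Mean-square convergence of the increment ratio\<close>

theorem proposition2p2:
  fixes p q :: nat and a :: "nat \<Rightarrow> real"
    and M :: "'w measure" and X :: "real \<Rightarrow> 'w \<Rightarrow> real"
    and A :: "real \<Rightarrow> real \<Rightarrow> real"
    and N :: "real \<Rightarrow> 'v measure" and Y :: "real \<Rightarrow> real \<Rightarrow> 'v \<Rightarrow> real"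
  assumes "1 \<le> p" and "p \<le> q" and "a \<in> filter_class p q"
    and "random_process M {0..1} X"
    and "assumption_A M X A N Y"
    and "AE t in lborel. t \<in> {0<..<1} \<longrightarrow>
           (\<forall>j\<in>{0, 1}. measure (N t)
              {v \<in> space (N t). \<bar>filter_diff q a (\<lambda>i. Y t (real i) v) j\<bar> > 0} = 1)"
  shows "(\<lambda>n. \<integral>w. (increment_ratio q a n (\<lambda>t. X t w) - limit_ratio q a N Y)\<^sup>2 \<partial>M)
           \<longlonglongrightarrow> 0"
proof -
  note X = assms(4)
  interpret M: prob_space M using X by (simp add: random_process_def)
  \<comment> \<open>The moment condition of order 0, available since \<open>1 \<le> p\<close>;
    \<open>0 ^ 0 = 1\<close> makes it the plain sum.\<close>
  have a: "(\<Sum>l\<le>q. a l) = 0"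
    using assms(1,3) unfolding filter_class_def by force
  define \<eta> where "\<eta> n k w = pratio (grid_inc q a n k (\<lambda>t. X t w))" for n k w
  define \<Lambda> where "\<Lambda> t = mean_ratio q a (N t) (Y t)" for t
  define e where "e n = steps n (n - q) (\<lambda>k. \<integral>w. \<eta> n k w \<partial>M)" for n
  define G where "G n = steps2 n (n - q) (\<lambda>k l. \<integral>w. \<eta> n k w * \<eta> n l w \<partial>M)" for n
  define nz where "nz t \<longleftrightarrow> (AE v in N t. fst (unit_inc q a (\<lambda>\<tau>. Y t \<tau> v)) \<noteq> 0)" for t
  have \<eta>_bounds: "0 \<le> \<eta> n k w" "\<eta> n k w \<le> 1" for n k w
    by (simp_all add: \<eta>_def pratio_bounds)
  have \<eta>_abs: "\<bar>\<eta> n k w\<bar> \<le> 1" for n k w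
    using \<eta>_bounds[of n k w] by simp
  have \<eta>_prod: "\<bar>\<eta> n k w * \<eta> n l w\<bar> \<le> 1" for n k l w
    using \<eta>_bounds by (simp add: abs_mult mult_le_one)
  have \<eta>_meas: "\<eta> n k \<in> borel_measurable M" if "k < n - q" for n k
    unfolding \<eta>_def[abs_def] by (intro measurable_compose[OF measurable_grid_inc[OF X that]] measurable_pratio)
  have \<eta>_int: "integrable M (\<eta> n k)" if "k < n - q" for n k
    using \<eta>_meas[OF that] \<eta>_abs by (auto intro!: M.integrable_const_bound[where B = 1])
  have \<eta>_prod_int: "integrable M (\<lambda>w. \<eta> n k w * \<eta> n l w)" if "k < n - q" "l < n - q" for n k l
    using \<eta>_meas[OF that(1)] \<eta>_meas[OF that(2)] \<eta>_prod
    by (auto intro!: M.integrable_const_bound[where B = 1])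
  \<comment> \<open>The step function bounds range over all indices, including those beyond
    \<open>n - q\<close> where \<open>\<eta> n k\<close> may fail to be measurable; there the
    default value 0 of the integral keeps the bound true.\<close>
  have abs_int: "\<bar>\<integral>w. f w \<partial>M\<bar> \<le> 1" if "\<And>w. \<bar>f w\<bar> \<le> 1" for f :: "'w \<Rightarrow> real"
  proof (cases "integrable M f")
    case True
    have "\<bar>\<integral>w. f w \<partial>M\<bar> \<le> (\<integral>w. \<bar>f w\<bar> \<partial>M)" by (rule integral_abs_bound)
    also have "\<dots> \<le> (\<integral>w. 1 \<partial>M)" using True that by (intro integral_mono) auto
    finally show ?thesis by (simp add: M.prob_space)
  qed (simp add: not_integrable_integral_eq)
  have [measurable]: "e n \<in> borel_measurable borel" for n
    unfolding e_def by (rule borel_measurable_steps)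
  have [measurable]: "G n \<in> borel_measurable (lborel \<Otimes>\<^sub>M lborel)" for n
    using borel_measurable_steps2 unfolding G_def by (simp cong: measurable_cong_sets)
  have e_bd: "\<bar>e n t\<bar> \<le> indicator {0..1} t" if "0 < n" for n t
    unfolding e_def
    by (rule abs_steps_le[OF that, of _ _ 1, simplified]) (use abs_int[OF \<eta>_abs] in auto)
  have G_bd: "\<bar>G n z\<bar> \<le> indicator ({0..1} \<times> {0..1}) z" if "0 < n" for n z
    unfolding G_def by (rule abs_steps2_le[OF that]) (auto intro: abs_int \<eta>_prod)
  have R_eq: "increment_ratio q a n (\<lambda>t. X t w) = (\<Sum>k<n - q. \<eta> n k w) / real (n - q)" for n w
    by (simp add: increment_ratio_def \<eta>_def pratio_def grid_inc_def)
  have e_int: "(LINT t|lborel. e n t) = (\<Sum>k<n - q. \<integral>w. \<eta> n k w \<partial>M) / real n" if "0 < n" for n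
    unfolding e_def by (rule integral_steps[OF that])
  have G_int: "integral\<^sup>L (lborel \<Otimes>\<^sub>M lborel) (G n)
      = (\<Sum>k<n - q. \<Sum>l<n - q. \<integral>w. \<eta> n k w * \<eta> n l w \<partial>M) / (real n)\<^sup>2" if "0 < n" for n
    unfolding G_def by (rule integral_steps2[OF that]) (auto intro: abs_int \<eta>_prod)
  \<comment> \<open>The increment ratio averages over \<open>n - q\<close> cells while the integral
    weights each cell by \<open>1 / n\<close>; \<open>c n\<close> corrects for this.\<close>
  define c where "c n = real n / real (n - q)" for n
  have c_lim: "c \<longlonglongrightarrow> 1"
  proof (rule Lim_transform_eventually)
    show "(\<lambda>n. 1 / (1 - real q * (1 / real n))) \<longlonglongrightarrow> 1"
      using tendsto_divide[OF tendsto_const[of 1] tendsto_diff[OF tendsto_const[of 1]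
            tendsto_mult[OF tendsto_const[of "real q"] lim_1_over_n]]] by simp
    show "\<forall>\<^sub>F n in sequentially. 1 / (1 - real q * (1 / real n)) = c n"
      using eventually_gt_at_top[of q]
      by eventually_elim (simp add: c_def of_nat_diff field_simps)
  qed
  have ER: "(\<integral>w. increment_ratio q a n (\<lambda>t. X t w) \<partial>M) = c n * (LINT t|lborel. e n t)"
    and ER2: "(\<integral>w. (increment_ratio q a n (\<lambda>t. X t w))\<^sup>2 \<partial>M) = (c n)\<^sup>2 * integral\<^sup>L (lborel \<Otimes>\<^sub>M lborel) (G n)"
    and R_int: "integrable M (\<lambda>w. increment_ratio q a n (\<lambda>t. X t w))"
      "integrable M (\<lambda>w. (increment_ratio q a n (\<lambda>t. X t w))\<^sup>2)" if "q < n" for n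
  proof -
    have sq: "(increment_ratio q a n (\<lambda>t. X t w))\<^sup>2
        = (\<Sum>k<n - q. \<Sum>l<n - q. \<eta> n k w * \<eta> n l w) / (real (n - q))\<^sup>2" for w
      by (simp add: R_eq power_divide power2_eq_square sum_product)
    show "integrable M (\<lambda>w. increment_ratio q a n (\<lambda>t. X t w))"
      "integrable M (\<lambda>w. (increment_ratio q a n (\<lambda>t. X t w))\<^sup>2)"
      unfolding sq unfolding R_eq
      by (intro integrable_divide Bochner_Integration.integrable_sum \<eta>_int \<eta>_prod_int; simp)+
    show "(\<integral>w. increment_ratio q a n (\<lambda>t. X t w) \<partial>M) = c n * (LINT t|lborel. e n t)"
      using that \<eta>_int by (simp add: R_eq e_int c_def Bochner_Integration.integral_sum)
    have "(\<integral>w. (\<Sum>k<n - q. \<Sum>l<n - q. \<eta> n k w * \<eta> n l w) \<partial>M)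
        = (\<Sum>k<n - q. \<Sum>l<n - q. \<integral>w. \<eta> n k w * \<eta> n l w \<partial>M)"
      by (intro trans[OF Bochner_Integration.integral_sum] sum.cong refl
          Bochner_Integration.integral_sum Bochner_Integration.integrable_sum \<eta>_prod_int) simp_all
    then show "(\<integral>w. (increment_ratio q a n (\<lambda>t. X t w))\<^sup>2 \<partial>M) = (c n)\<^sup>2 * integral\<^sup>L (lborel \<Otimes>\<^sub>M lborel) (G n)"
      using that by (simp add: sq G_int c_def power_divide)
  qed
  \<comment> \<open>What (A) yields at almost every pair. \<open>nz\<close> stays a premise here:
    deriving it needs \<open>N t\<close> to be a probability space, which is itself extracted from
    this statement below.\<close>
  have AE_A: "AE z in lborel \<Otimes>\<^sub>M lborel. fst z \<in> {0<..<1} \<and> snd z \<in> {0<..<1} \<and> fst z \<noteq> snd z \<longrightarrow>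
      random_process (N (fst z)) {0..} (Y (fst z)) \<and>
      (nz (fst z) \<longrightarrow> (\<lambda>n. e n (fst z)) \<longlonglongrightarrow> \<Lambda> (fst z)) \<and>
      (nz (fst z) \<and> nz (snd z) \<longrightarrow> (\<lambda>n. G n z) \<longlonglongrightarrow> \<Lambda> (fst z) * \<Lambda> (snd z))"
    using assms(5) unfolding assumption_A_def lborel_prod[symmetric]
  proof eventually_elim
    case (elim z)
    show ?case
    proof (clarify, goal_cases)
      case 1
      obtain t1 t2 where z: "z = (t1, t2)" by (cases z)
      have t: "t1 \<in> {0<..<1}" "t2 \<in> {0<..<1}" "t1 \<noteq> t2" using 1 z by auto
      from elim t obtain Q :: "((real \<Rightarrow> real) \<times> (real \<Rightarrow> real)) measure" and Z1 Z2 where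
        A: "filterlim (A t1) at_top (at_right 0)" "filterlim (A t2) at_top (at_right 0)"
        and Y: "random_process (N t1) {0..} (Y t1)" "random_process (N t2) {0..} (Y t2)"
        and Z: "random_process Q {0..} Z1" "random_process Q {0..} Z2" "indep_processes Q Z1 Z2"
           "process_law Q Z1 = process_law (N t1) (Y t1)" "process_law Q Z2 = process_law (N t2) (Y t2)"
        and fdd: "fdd_converges (at_right 0 \<times>\<^sub>F (nhds t1 \<times>\<^sub>F nhds t2))
             M (\<lambda>(\<delta>, s1, s2) \<tau> w. (A t1 \<delta> * (X (s1 + \<delta> * \<tau>) w - X s1 w),
                                       A t2 \<delta> * (X (s2 + \<delta> * \<tau>) w - X s2 w)))
             Q (\<lambda>\<tau> v. (Z1 \<tau> v, Z2 \<tau> v))"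
        unfolding z by blast
      have idx: "\<forall>\<^sub>F n in sequentially. nat \<lfloor>real n * t1\<rfloor> < n - q" "\<forall>\<^sub>F n in sequentially. nat \<lfloor>real n * t2\<rfloor> < n - q"
        using t by (intro eventually_grid_index_less; simp)+
      have "(\<lambda>n. e n t1) \<longlonglongrightarrow> \<Lambda> t1" if "nz t1"
      proof (rule Lim_transform_eventually)
        show "(\<lambda>n. \<integral>w. \<eta> n (nat \<lfloor>real n * t1\<rfloor>) w \<partial>M) \<longlonglongrightarrow> \<Lambda> t1"
          unfolding \<eta>_def \<Lambda>_def
          by (rule grid_ratio_limit[OF X a t(1,2) A Y Z fdd that[unfolded nz_def]])
        show "\<forall>\<^sub>F n in sequentially. (\<integral>w. \<eta> n (nat \<lfloor>real n * t1\<rfloor>) w \<partial>M) = e n t1"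
          using idx(1) eventually_gt_at_top[of 0]
          by eventually_elim (use t in \<open>simp add: e_def steps_eq\<close>)
      qed
      moreover have "(\<lambda>n. G n (t1, t2)) \<longlonglongrightarrow> \<Lambda> t1 * \<Lambda> t2" if "nz t1" "nz t2"
      proof (rule Lim_transform_eventually)
        show "(\<lambda>n. \<integral>w. \<eta> n (nat \<lfloor>real n * t1\<rfloor>) w * \<eta> n (nat \<lfloor>real n * t2\<rfloor>) w \<partial>M) \<longlonglongrightarrow> \<Lambda> t1 * \<Lambda> t2"
          unfolding \<eta>_def \<Lambda>_def
          by (rule grid_ratio_limit_pair[OF X a t(1,2) A Y Z fdd that[unfolded nz_def]])
        show "\<forall>\<^sub>F n in sequentially. (\<integral>w. \<eta> n (nat \<lfloor>real n * t1\<rfloor>) w * \<eta> n (nat \<lfloor>real n * t2\<rfloor>) w \<partial>M) = G n (t1, t2)"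
          using idx eventually_gt_at_top[of 0]
          by eventually_elim (use t in \<open>simp add: G_def steps2_def steps_eq\<close>)
      qed
      ultimately show ?case using Y(1) by (simp add: z)
    qed
  qed
  \<comment> \<open>From pairs to single times: by Fubini, for almost every \<open>t\<close> the
    pair statement holds for almost every \<open>s\<close>. Since (0,1) without \<open>t\<close> has
    measure 1, some admissible \<open>s\<close> exists, and the conclusion about \<open>t\<close>
    does not mention it.\<close>
  have ex: "AE t in lborel. t \<in> {0<..<1} \<longrightarrow> random_process (N t) {0..} (Y t) \<and> (nz t \<longrightarrow> (\<lambda>n. e n t) \<longlonglongrightarrow> \<Lambda> t)"
    using lborel_pair.AE_pair[OF AE_A]
  proof eventually_elim
    case (elim t)
    have "\<not> (AE s in lborel. s \<notin> {0<..<1::real} - {t})"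
    proof
      assume "AE s in lborel. s \<notin> {0<..<1::real} - {t}"
      then have "emeasure lborel ({0<..<1::real} - {t}) = 0"
        by (subst (asm) AE_iff_measurable[where N = "{0<..<1::real} - {t}"]) auto
      moreover have "emeasure lborel ({0<..<1::real} - {t}) = emeasure lborel {0<..<1::real}"
        by (rule emeasure_Diff_null_set) auto
      ultimately show False by simp
    qed
    show ?case
    proof (rule ccontr)
      assume contra: "\<not> ?case"
      from elim have "AE s in lborel. s \<notin> {0<..<1::real} - {t}"
        by eventually_elim (use contra in auto)
      with \<open>\<not> (AE s in lborel. s \<notin> {0<..<1::real} - {t})\<close> show False by blast
    qed
  qed
  \<comment> \<open>Probability one becomes an almost sure statement, now that \<open>N t\<close> is
    known to be a probability space for almost every \<open>t\<close>.\<close>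
  have nz: "AE t in lborel. t \<in> {0<..<1} \<longrightarrow> nz t"
    using assms(6) ex
  proof eventually_elim
    case (elim t)
    show ?case
    proof
      assume t: "t \<in> {0<..<1}"
      with elim have Y: "random_process (N t) {0..} (Y t)" by simp
      then interpret Nt: prob_space "N t" by (simp add: random_process_def)
      have "Nt.prob {v \<in> space (N t). \<bar>filter_diff q a (\<lambda>i. Y t (real i) v) 0\<bar> > 0} = 1"
        using elim t by simp
      then have "AE v in N t. \<bar>filter_diff q a (\<lambda>i. Y t (real i) v) 0\<bar> > 0"
        by (rule Nt.AE_prob_1[THEN AE_mp]) auto
      then show "nz t" unfolding nz_def by (simp add: unit_inc_def)
    qed
  qed
  have e_lim: "AE t in lborel. t \<in> {0<..<1} \<longrightarrow> (\<lambda>n. e n t) \<longlonglongrightarrow> \<Lambda> t"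
    using ex nz by eventually_elim auto
  \<comment> \<open>A Borel version of \<open>\<Lambda>\<close> on the unit interval:
    \<open>\<Lambda>\<close> itself may be irregular on a null set, whereas a limit of the Borel
    functions \<open>e n\<close> is Borel.\<close>
  define \<Lambda>' where "\<Lambda>' t = indicator {0<..<1} t * lim (\<lambda>n. e n t)" for t
  have [measurable]: "\<Lambda>' \<in> borel_measurable borel"
    unfolding \<Lambda>'_def[abs_def] by measurable
  have \<Lambda>': "AE t in lborel. \<Lambda>' t = indicator {0..1} t * \<Lambda> t"
    using e_lim AE_lborel_singleton[of 0] AE_lborel_singleton[of 1]
    by eventually_elim (auto simp: \<Lambda>'_def indicator_def dest: limI)
  \<comment> \<open>The completed measure makes the original integrand measurable, being almost
    everywhere equal to the Borel function \<open>\<Lambda>'\<close>; the integral then descends to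
    \<open>lborel\<close>.\<close>
  have limit_eq: "limit_ratio q a N Y = (LINT t|lborel. \<Lambda>' t)"
  proof -
    have "limit_ratio q a N Y = (LINT t|lebesgue. indicator {0..1} t * \<Lambda> t)"
      by (simp add: limit_ratio_def set_lebesgue_integral_def \<Lambda>_def mean_ratio_def pratio_def unit_inc_def)
    also have "\<dots> = (LINT t|lebesgue. \<Lambda>' t)"
    proof (rule integral_cong_AE)
      have m: "\<Lambda>' \<in> borel_measurable lebesgue" by (simp add: measurable_completion)
      show "\<Lambda>' \<in> borel_measurable lebesgue" by fact
      show "AE t in lebesgue. indicator {0..1} t * \<Lambda> t = \<Lambda>' t"
        using AE_completion[OF \<Lambda>'] by eventually_elim simp
      show "(\<lambda>t. indicator {0..1} t * \<Lambda> t) \<in> borel_measurable lebesgue"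
        by (rule borel_measurable_AE[OF m AE_completion[OF \<Lambda>']])
    qed
    also have "\<dots> = (LINT t|lborel. \<Lambda>' t)"
      by (rule integral_completion) simp
    finally show ?thesis .
  qed
  have e0: "(\<lambda>n. e n t) \<longlonglongrightarrow> 0" if "t \<notin> {0..1}" for t
  proof (rule tendsto_eventually, rule eventually_sequentiallyI[of 1])
    show "e n t = 0" if "1 \<le> n" for n
      using e_bd[of n t] that \<open>t \<notin> {0..1}\<close> by simp
  qed
  have e_\<Lambda>': "AE t in lborel. (\<lambda>n. e n t) \<longlonglongrightarrow> \<Lambda>' t"
    using e_lim \<Lambda>' AE_lborel_singleton[of 0] AE_lborel_singleton[of 1]
  proof eventually_elim
    case (elim t)
    then show ?case using e0[of t] by (cases "t \<in> {0..1}") auto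
  qed
  \<comment> \<open>Inherited from \<open>e n\<close> in the limit; it yields the integrability of
    the product that Fubini requires below.\<close>
  have \<Lambda>'_bd: "AE t in lborel. \<bar>\<Lambda>' t\<bar> \<le> indicator {0..1} t"
    using e_\<Lambda>'
  proof eventually_elim
    case (elim t)
    show ?case
      by (rule tendsto_upperbound[OF tendsto_rabs[OF elim] eventually_sequentiallyI[of 1]]) (auto simp: e_bd)
  qed
  have \<Lambda>'_int: "integrable (lborel \<Otimes>\<^sub>M lborel) (\<lambda>z. \<Lambda>' (fst z) * \<Lambda>' (snd z))"
  proof (rule Bochner_Integration.integrable_bound[OF integrable_unit_square])
    show "AE z in lborel \<Otimes>\<^sub>M lborel. norm (\<Lambda>' (fst z) * \<Lambda>' (snd z)) \<le> norm (indicator ({0..1} \<times> {0..1}) z :: real)"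
      using AE_lborel_pair_fst[OF \<Lambda>'_bd] AE_lborel_pair_snd[OF \<Lambda>'_bd]
    proof eventually_elim
      case (elim z)
      have "\<bar>\<Lambda>' (fst z)\<bar> * \<bar>\<Lambda>' (snd z)\<bar> \<le> indicator {0..1} (fst z) * indicator {0..1} (snd z)"
        using elim by (intro mult_mono) auto
      then show ?case by (simp add: abs_mult indicator_times)
    qed
  qed simp
  have e_int_lim: "(\<lambda>n. LINT t|lborel. e n t) \<longlonglongrightarrow> limit_ratio q a N Y"
    unfolding limit_eq
    by (rule tendsto_integral_dominated[where b = "indicator {0..1}"]) (simp_all add: e_bd e_\<Lambda>')
  have G_int_lim: "(\<lambda>n. integral\<^sup>L (lborel \<Otimes>\<^sub>M lborel) (G n)) \<longlonglongrightarrow> (limit_ratio q a N Y)\<^sup>2"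
  proof -
    \<comment> \<open>Inside the open square, off the diagonal, this is \<open>AE_A\<close>; outside
      the closed square both sides vanish. The diagonal and the four boundary lines are
      null.\<close>
    have "AE z in lborel \<Otimes>\<^sub>M lborel. (\<lambda>n. G n z) \<longlonglongrightarrow> \<Lambda>' (fst z) * \<Lambda>' (snd z)"
      using AE_A AE_lborel_pair_off_diagonal AE_lborel_pair_fst[OF nz] AE_lborel_pair_snd[OF nz] AE_lborel_pair_fst[OF \<Lambda>'] AE_lborel_pair_snd[OF \<Lambda>']
        AE_lborel_pair_fst[OF AE_lborel_singleton[of 0]] AE_lborel_pair_fst[OF AE_lborel_singleton[of 1]]
        AE_lborel_pair_snd[OF AE_lborel_singleton[of 0]] AE_lborel_pair_snd[OF AE_lborel_singleton[of 1]]
    proof eventually_elim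
      case (elim z)
      show ?case
      proof (cases "z \<in> {0..1} \<times> {0..1}")
        case True
        with elim show ?thesis by (auto simp: mem_Times_iff)
      next
        case False
        have "(\<lambda>n. G n z) \<longlonglongrightarrow> 0"
          by (rule tendsto_eventually, rule eventually_sequentiallyI[of 1])
            (use G_bd[of _ z] False in auto)
        with False elim(5,6) show ?thesis by (auto simp: mem_Times_iff)
      qed
    qed
    then have "(\<lambda>n. integral\<^sup>L (lborel \<Otimes>\<^sub>M lborel) (G n))
        \<longlonglongrightarrow> integral\<^sup>L (lborel \<Otimes>\<^sub>M lborel) (\<lambda>z. \<Lambda>' (fst z) * \<Lambda>' (snd z))"
      by (intro tendsto_integral_dominated[OF integrable_unit_square]) (simp_all add: G_bd)
    also have "integral\<^sup>L (lborel \<Otimes>\<^sub>M lborel) (\<lambda>z. \<Lambda>' (fst z) * \<Lambda>' (snd z))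
        = (LINT t|lborel. \<Lambda>' t) * (LINT t|lborel. \<Lambda>' t)"
      using lborel_pair.integral_fst'[OF \<Lambda>'_int, symmetric] by simp
    finally show ?thesis by (simp add: limit_eq power2_eq_square)
  qed
  let ?L = "limit_ratio q a N Y"
  \<comment> \<open>The expanded square with the moments rewritten by \<open>ER\<close> and
    \<open>ER2\<close>, which is legitimate for \<open>n > q\<close>, hence eventually.\<close>
  have "(\<lambda>n. (c n)\<^sup>2 * integral\<^sup>L (lborel \<Otimes>\<^sub>M lborel) (G n) - 2 * ?L * (c n * (LINT t|lborel. e n t)) + ?L\<^sup>2)
      \<longlonglongrightarrow> 1\<^sup>2 * ?L\<^sup>2 - 2 * ?L * (1 * ?L) + ?L\<^sup>2"
    by (intro tendsto_intros c_lim e_int_lim G_int_lim)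
  then have "(\<lambda>n. (c n)\<^sup>2 * integral\<^sup>L (lborel \<Otimes>\<^sub>M lborel) (G n) - 2 * ?L * (c n * (LINT t|lborel. e n t)) + ?L\<^sup>2)
      \<longlonglongrightarrow> 0"
    by (simp add: power2_eq_square)
  then show ?thesis
  proof (rule Lim_transform_eventually)
    show "\<forall>\<^sub>F n in sequentially. (c n)\<^sup>2 * integral\<^sup>L (lborel \<Otimes>\<^sub>M lborel) (G n) - 2 * ?L * (c n * (LINT t|lborel. e n t)) + ?L\<^sup>2
        = (\<integral>w. (increment_ratio q a n (\<lambda>t. X t w) - ?L)\<^sup>2 \<partial>M)"
      using eventually_gt_at_top[of q]
    proof eventually_elim
      case (elim n)
      show ?case
        using R_int[OF elim] ER[OF elim] ER2[OF elim] by (simp add: power2_diff M.prob_space)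
    qed
  qed
qed

end
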